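(* Let $r, d$ be positive integers. Given a family $\mathcal{F}$ of $(r-1)\frac{d(d+1)}{2}+1$ ellipsoids of volume one in $\mathbb{R}^d$, each centered at the origin, there exists a partition of $\mathcal{F}$ into $r$ parts $A_1, \ldots, A_r$ such that $\bigcap_{j=1}^r \operatorname{conv}\left(\bigcup A_j\right)$ contains an ellipsoid of volume one centered at the origin.
   Context: An ellipsoid in $\mathbb{R}^d$ is the image of the Euclidean unit ball under an invertible affine map; it is centered at the origin if it is symmetric about $0$. $\operatorname{conv}$ is the convex hull. *)

theory Defs
  imports "HOL-Analysis.Analysis" "HOL-Library.Disjoint_Sets"
begin

definition ellipsoid :: "(real ^ 'n) set \<Rightarrow> bool" where
  "ellipsoid E \<longleftrightarrow>
     (\<exists>(L :: real ^ 'n \<Rightarrow> real ^ 'n) c. linear L \<and> bij L \<and> E = (\<lambda>x. c + L x) ` cball 0 1)"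

definition centered_at_origin :: "(real ^ 'n) set \<Rightarrow> bool" where
  "centered_at_origin E \<longleftrightarrow> uminus ` E = E"

end

theory Submission
  imports Defs
begin

text \<open>
  A centered ellipsoid \<open>A ` cball 0 1\<close> is determined by the positive definite matrix
  \<open>M = A ** transpose A\<close>, whose quadratic form is the square of its support function; hence the
  ellipsoid of a convex combination of such matrices lies in the convex hull of the union of the
  ellipsoids. The symmetric matrices form a space of dimension \<open>d (d + 1) / 2\<close>, and a version of
  Tverberg's theorem for cones (one dimension cheaper than the affine one) splits the matrices into
  \<open>r\<close> classes whose nonnegative combinations meet in a common nonzero matrix \<open>S\<close>. By Minkowski's
  determinant inequality each normalised combination, a multiple of \<open>S\<close>, describes an ellipsoid of
  volume at least one, so the multiple of \<open>S\<close> describing volume one is contained in all of them.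
\<close>

section \<open>Colourful Caratheodory and conic Tverberg theorems\<close>

text \<open>Gaussian elimination, by induction on the equations: an equation with a nonzero
  coefficient is solved for one unknown, which costs one equation and one unknown, so unknowns stay
  in the majority.\<close>

lemma homogeneous_system_nontrivial_solution:
  fixes a :: "'i \<Rightarrow> 'k \<Rightarrow> real"
  assumes "finite K" "finite I" "card K < card I"
  shows "\<exists>c. (\<exists>i\<in>I. c i \<noteq> 0) \<and> (\<forall>k\<in>K. (\<Sum>i\<in>I. c i * a i k) = 0)"
  using assms
proof (induction K arbitrary: I a rule: finite_induct)
  case empty
  then obtain i where "i \<in> I" by (metis card.empty card_gt_0_iff equals0I)
  then show ?case by (intro exI[of _ "\<lambda>_. 1"]) auto
next
  case (insert l K)
  show ?case
  proof (cases "\<exists>p\<in>I. a p l \<noteq> 0")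
    case False
    have "card K < card I" using insert by simp
    from insert.IH[OF insert.prems(1) this, of a] False show ?thesis
      by (auto intro!: sum.neutral)
  next
    case True
    then obtain p where p: "p \<in> I" "a p l \<noteq> 0" by blast
    \<comment> \<open>\<open>b\<close> is the system left after eliminating the pivot unknown
      \<open>p\<close> by means of equation \<open>l\<close>; \<open>c'\<close> below recovers the
      value at \<open>p\<close> by back substitution.\<close>
    define b where "b i k = a i k - a i l / a p l * a p k" for i k
    have "card K < card (I - {p})" using insert p by simp
    then obtain c where c: "\<exists>i\<in>I-{p}. c i \<noteq> 0"
      "\<forall>k\<in>K. (\<Sum>i\<in>I-{p}. c i * b i k) = 0"
      using insert.IH[of "I - {p}" b] insert.prems by auto
    define c' where "c' i = (if i = p then - (\<Sum>i\<in>I-{p}. c i * a i l) / a p l else c i)" for i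
    have eq: "(\<Sum>i\<in>I. c' i * a i k) =
        (\<Sum>i\<in>I-{p}. c i * a i k) - (\<Sum>i\<in>I-{p}. c i * a i l) / a p l * a p k" for k
    proof -
      have "(\<Sum>i\<in>I. c' i * a i k) = c' p * a p k + (\<Sum>i\<in>I-{p}. c' i * a i k)"
        using insert.prems p by (simp add: sum.remove)
      also have "(\<Sum>i\<in>I-{p}. c' i * a i k) = (\<Sum>i\<in>I-{p}. c i * a i k)"
        by (intro sum.cong) (auto simp: c'_def)
      finally show ?thesis by (simp add: c'_def)
    qed
    have "(\<Sum>i\<in>I. c' i * a i k) = (\<Sum>i\<in>I-{p}. c i * b i k)" for k
      unfolding eq b_def
      by (simp add: right_diff_distrib sum_subtractf sum_divide_distrib sum_distrib_right mult.assoc)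
    moreover have "(\<Sum>i\<in>I. c' i * a i l) = 0"
      using p by (simp add: eq)
    moreover have "\<exists>i\<in>I. c' i \<noteq> 0" using c(1) by (auto simp: c'_def)
    ultimately show ?thesis using c(2) by (intro exI[of _ c']) auto
  qed
qed

text \<open>The simplex is a closed subset of a product of compact sets, so Tychonoff applies.
  Fixing the value 0 outside \<open>I\<close> is what makes the remaining factors compact.\<close>

lemma compact_weights:
  fixes I :: "'i set"
  assumes "finite I"
  shows "compact {u :: 'i \<Rightarrow> real. (\<forall>i\<in>I. 0 \<le> u i) \<and> (\<forall>i. i \<notin> I \<longrightarrow> u i = 0) \<and> sum u I = 1}"
    (is "compact ?S")
proof -
  let ?T = "PiE UNIV (\<lambda>i. if i \<in> I then {0..1::real} else {0})"
  have "compactin (product_topology (\<lambda>i. euclidean) UNIV) ?T"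
    unfolding compactin_PiE by (auto)
  then have "compact ?T"
    by (simp add: euclidean_product_topology)
  moreover have "closed {u :: 'i \<Rightarrow> real. sum u I = 1}"
    by (intro closed_Collect_eq continuous_intros continuous_on_sum) auto
  ultimately have "compact (?T \<inter> {u. sum u I = 1})"
    by blast
  moreover have "?T \<inter> {u. sum u I = 1} = ?S"
  proof safe
    fix u :: "'i \<Rightarrow> real" and i assume "\<forall>i\<in>I. 0 \<le> u i" "sum u I = 1" "\<forall>i. i \<notin> I \<longrightarrow> u i = 0"
    then show "u i \<in> (if i \<in> I then {0..1} else {0})"
      using member_le_sum[of i I u] assms by auto
  qed (auto simp: PiE_def Pi_def split: if_splits)
  ultimately show ?thesis by simp
qed

text \<open>Barany's argument: if the point \<open>p\<close> of minimal norm over all colourful simplices were nonzero,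
  it would be a convex combination avoiding some colour, and swapping in a point of that colour on
  the other side of the hyperplane orthogonal to \<open>p\<close> would decrease the norm.\<close>

lemma colourful_caratheodory:
  fixes w :: "'i \<Rightarrow> 'j \<Rightarrow> 'k \<Rightarrow> real"
  assumes "finite I" "finite J" "finite K" "card K < card I"
    and origin: "\<And>i q. i \<in> I \<Longrightarrow> \<exists>j\<in>J. (\<Sum>k\<in>K. w i j k * q k) \<le> 0"
  shows "\<exists>f u. f \<in> I \<rightarrow> J \<and> (\<forall>i\<in>I. 0 \<le> u i) \<and> sum u I = 1 \<and>
           (\<forall>k\<in>K. (\<Sum>i\<in>I. u i * w i (f i) k) = 0)"
proof -
  define S where "S = {u :: 'i \<Rightarrow> real. (\<forall>i\<in>I. 0 \<le> u i) \<and> (\<forall>i. i \<notin> I \<longrightarrow> u i = 0) \<and> sum u I = 1}"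
  define P where "P f u k = (\<Sum>i\<in>I. u i * w i (f i) k)" for f u k
  define ip where "ip p q = (\<Sum>k\<in>K. p k * q k)" for p q :: "'k \<Rightarrow> real"
  define F where "F f u = ip (P f u) (P f u)" for f u
  have "I \<noteq> {}" using assms by auto
  then obtain i0 where i0: "i0 \<in> I" by blast
  have "(\<lambda>i. if i = i0 then 1 else 0) \<in> S"
    using i0 assms by (auto simp: S_def)
  then have "S \<noteq> {}" by blast
  have "\<exists>u\<in>S. \<forall>v\<in>S. F f u \<le> F f v" for f
    unfolding F_def P_def ip_def
    by (intro continuous_attains_inf \<open>S \<noteq> {}\<close>)
      (auto simp: S_def intro!: compact_weights assms continuous_intros
        intro: continuous_on_subset[OF continuous_on_product_coordinates])
  \<comment> \<open>The minimum is taken in two stages: over the weights by compactness for each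
    choice \<open>f\<close>, then over the finitely many choices.\<close>
  then obtain U where U: "\<And>f. U f \<in> S" "\<And>f v. v \<in> S \<Longrightarrow> F f (U f) \<le> F f v" by metis
  have "finite (PiE I (\<lambda>_. J))" using assms by (simp add: finite_PiE)
  moreover have "J \<noteq> {}" using origin[OF i0] by blast
  then have "PiE I (\<lambda>_. J) \<noteq> {}" by (simp add: PiE_eq_empty_iff)
  ultimately obtain f0 where f0: "f0 \<in> PiE I (\<lambda>_. J)"
    "\<And>f. f \<in> PiE I (\<lambda>_. J) \<Longrightarrow> F f0 (U f0) \<le> F f (U f)"
    using arg_min_if_finite[of "PiE I (\<lambda>_. J)" "\<lambda>f. F f (U f)"] by (meson linorder_not_le)
  define m where "m = F f0 (U f0)"
  have m_le: "m \<le> F f u" if "f \<in> PiE I (\<lambda>_. J)" "u \<in> S" for f u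
    using f0(2)[OF that(1)] U(2)[OF that(2), of f] by (simp add: m_def)
  have ip_P: "ip (P f u) q = (\<Sum>i\<in>I. u i * ip (w i (f i)) q)" for f u q
    unfolding ip_def P_def sum_distrib_right sum_distrib_left
    by (subst sum.swap) (simp add: mult.assoc)
  \<comment> \<open>First-order condition at any minimiser, not only at \<open>f0\<close>: otherwise
    a short move from \<open>P f u\<close> towards the chosen point of colour \<open>i\<close> would
    decrease the norm.\<close>
  have optimal: "m \<le> ip (w i (f i)) (P f u)"
    if f: "f \<in> PiE I (\<lambda>_. J)" and u: "u \<in> S" and Fm: "F f u = m" and i: "i \<in> I" for f u i
  proof (rule ccontr)
    assume less: "\<not> ?thesis"
    define p q where "p = P f u" and "q = w i (f i)"
    define e where "e = m - ip q p"
    have e: "e > 0" using less by (simp add: e_def p_def q_def)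
    have pp: "ip p p = m" using Fm by (simp add: F_def p_def)
    have qq: "ip q q \<ge> 0" by (simp add: ip_def sum_nonneg)
    define D where "D = ip p p - 2 * ip q p + ip q q"
    have "D = ip (\<lambda>k. p k - q k) (\<lambda>k. p k - q k)"
      unfolding D_def ip_def by (simp add: algebra_simps sum.distrib sum_subtractf sum_distrib_left)
    then have D: "D \<ge> 0" by (simp add: ip_def sum_nonneg)
    \<comment> \<open>On the segment the squared norm is \<open>m - t * (2 * e - t * D)\<close>,
      where \<open>D\<close> is the squared distance of \<open>p\<close> and \<open>q\<close>, so a
      small positive \<open>t\<close> suffices; \<open>D + 1\<close> keeps the quotient meaningful
      when \<open>D = 0\<close>.\<close>
    define t where "t = min 1 (e / (D + 1))"
    have t: "0 < t" "t \<le> 1" "t * D < 2 * e"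
    proof -
      show "0 < t" "t \<le> 1" using e D by (auto simp: t_def)
      have "t * D \<le> e / (D + 1) * D" using D by (intro mult_right_mono) (auto simp: t_def)
      also have "\<dots> \<le> e" using e D by (simp add: field_simps)
      finally show "t * D < 2 * e" using e by simp
    qed
    define v where "v j = (1 - t) * u j + (if j = i then t else 0)" for j
    have "v \<in> S" using u t i assms(1)
      by (auto simp: S_def v_def sum.distrib sum_distrib_left[symmetric])
    have "P f v k = (1 - t) * p k + t * q k" for k
      unfolding P_def p_def q_def v_def using i assms(1)
      by (simp add: distrib_right sum.distrib sum_distrib_left mult.assoc if_distrib[of "\<lambda>x. x * _"] cong: if_cong)
    then have "F f v = ip (\<lambda>k. (1 - t) * p k + t * q k) (\<lambda>k. (1 - t) * p k + t * q k)"
      by (simp add: F_def fun_eq_iff ip_def)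
    also have "\<dots> = (\<Sum>k\<in>K. (1-t)^2 * (p k * p k) + 2 * t * (1 - t) * (q k * p k) + t^2 * (q k * q k))"
      unfolding ip_def by (intro sum.cong) (auto simp: algebra_simps power2_eq_square)
    also have "\<dots> = (1 - t)^2 * ip p p + 2 * t * (1 - t) * ip q p + t^2 * ip q q"
      unfolding ip_def by (simp add: sum.distrib sum_distrib_left)
    also have "\<dots> = m - t * (2 * e - t * D)"
      by (simp add: D_def e_def pp algebra_simps power2_eq_square)
    also have "\<dots> < m" using t by simp
    finally show False using m_le[OF f \<open>v \<in> S\<close>] by simp
  qed
  have "m = 0"
  proof (rule ccontr)
    assume "m \<noteq> 0"
    have "m \<ge> 0" by (simp add: m_def F_def ip_def sum_nonneg)
    then have m: "m > 0" using \<open>m \<noteq> 0\<close> by simp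
    define u where "u = U f0"
    define p where "p = P f0 u"
    have u: "u \<in> S" and Fu: "F f0 u = m" using U by (auto simp: u_def m_def)
    have pp: "ip p p = m" using Fu by (simp add: F_def p_def)
    have opt: "m \<le> ip (w i (f0 i)) p" if "i \<in> I" for i
      using optimal[OF f0(1) u Fu that] by (simp add: p_def)
    \<comment> \<open>Caratheodory reduction: the minimal point can be written with some colour of
      weight zero.\<close>
    have "\<exists>v\<in>S. \<exists>i\<in>I. v i = 0 \<and> (\<forall>k\<in>K. P f0 v k = p k)"
    proof (cases "\<exists>i\<in>I. u i = 0")
      case True
      then show ?thesis using u p_def by blast
    next
      case False
      then have upos: "u i > 0" if "i \<in> I" for i
        using u that by (force simp: S_def)
      \<comment> \<open>A weighted sum of nonnegative slacks vanishes and all weights are positive,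
        so every chosen point lies on the hyperplane where the product with \<open>p\<close> equals
        \<open>m\<close>.\<close>
      have "(\<Sum>i\<in>I. u i * (ip (w i (f0 i)) p - m)) = ip p p - m * sum u I"
        unfolding p_def ip_P by (simp add: algebra_simps sum_subtractf sum_distrib_left)
      also have "\<dots> = 0" using u pp by (simp add: S_def)
      finally have "\<forall>i\<in>I. u i * (ip (w i (f0 i)) p - m) = 0"
        using upos opt assms(1) by (subst (asm) sum_nonneg_eq_0_iff) (auto intro!: mult_nonneg_nonneg simp: less_imp_le)
      then have tight: "ip (w i (f0 i)) p = m" if "i \<in> I" for i
        using upos that by force
      \<comment> \<open>There are more chosen points than coordinates, hence a linear dependency.
        Since all points have the same nonzero product with \<open>p\<close>, its coefficients sum
        to 0, so shifting \<open>u\<close> along \<open>c\<close> preserves both the point and the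
        total weight.\<close>
      obtain c where c: "\<exists>i\<in>I. c i \<noteq> 0" "\<forall>k\<in>K. (\<Sum>i\<in>I. c i * w i (f0 i) k) = 0"
        using homogeneous_system_nontrivial_solution[of K I "\<lambda>i. w i (f0 i)"] assms by blast
      have "ip (P f0 c) p = 0" unfolding ip_def using c(2) by (simp add: P_def)
      then have "sum c I * m = 0" unfolding ip_P by (simp add: tight sum_distrib_right)
      then have csum: "sum c I = 0" using m by simp
      have "\<exists>i\<in>I. c i > 0"
      proof (rule ccontr)
        assume "\<not> ?thesis"
        then have "\<forall>i\<in>I. - c i \<ge> 0" by force
        moreover have "(\<Sum>i\<in>I. - c i) = 0" using csum by (simp add: sum_negf)
        ultimately have "\<forall>i\<in>I. - c i = 0" using assms(1) by (subst (asm) sum_nonneg_eq_0_iff) auto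
        then show False using c(1) by auto
      qed
      then have "{i\<in>I. c i > 0} \<noteq> {}" by blast
      then obtain i1 where i1: "i1 \<in> I" "c i1 > 0" "\<And>i. i \<in> I \<Longrightarrow> c i > 0 \<Longrightarrow> u i1 / c i1 \<le> u i / c i"
        using arg_min_if_finite[of "{i\<in>I. c i > 0}" "\<lambda>i. u i / c i"] assms(1)
        by (intro that[of "arg_min_on (\<lambda>i. u i / c i) {i\<in>I. c i > 0}"]) (auto simp: not_less[symmetric])
      \<comment> \<open>Ratio test: the largest shift keeping all weights nonnegative; it makes the
        weight of \<open>i1\<close> vanish.\<close>
      define t where "t = u i1 / c i1"
      have t: "t \<ge> 0" using i1 upos by (simp add: t_def less_imp_le)
      define v where "v i = (if i \<in> I then u i - t * c i else 0)" for i
      have "v i \<ge> 0" if "i \<in> I" for i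
      proof (cases "c i > 0")
        case True
        then show ?thesis using i1(3)[OF that True] that by (simp add: v_def t_def[symmetric] field_simps)
      next
        case False
        then have "t * c i \<le> 0" using t by (simp add: mult_nonneg_nonpos)
        then show ?thesis using upos[OF that] that by (simp add: v_def)
      qed
      then have "v \<in> S" using u csum
        by (auto simp: S_def v_def sum_subtractf sum_distrib_left[symmetric])
      moreover have "P f0 v k = p k" if "k \<in> K" for k
      proof -
        have "P f0 v k = (\<Sum>i\<in>I. u i * w i (f0 i) k) - t * (\<Sum>i\<in>I. c i * w i (f0 i) k)"
          unfolding P_def v_def by (simp add: left_diff_distrib sum_subtractf sum_distrib_left mult.assoc)
        then show ?thesis using c(2) that by (simp add: p_def P_def)
      qed
      moreover have "v i1 = 0" using i1 by (simp add: v_def t_def)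
      ultimately show ?thesis using i1(1) by blast
    qed
    then obtain v i where v: "v \<in> S" "i \<in> I" "v i = 0" "\<And>k. k \<in> K \<Longrightarrow> P f0 v k = p k" by blast
    obtain j where j: "j \<in> J" "ip (w i j) p \<le> 0" using origin[OF v(2), of p] by (auto simp: ip_def)
    \<comment> \<open>Colour \<open>i\<close> has weight zero, so changing its chosen point leaves
      \<open>p\<close> and minimality intact, while the new point violates \<open>optimal\<close>
      because \<open>m > 0\<close>.\<close>
    define g where "g = f0(i := j)"
    have g: "g \<in> PiE I (\<lambda>_. J)" using f0(1) j v(2) by (auto simp: g_def PiE_def Pi_def extensional_def)
    have Pg: "P g v = P f0 v"
      unfolding P_def by (intro ext sum.cong) (auto simp: g_def v(3))
    have ipg: "ip q (P g v) = ip q p" for q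
      unfolding ip_def Pg by (intro sum.cong) (auto simp: v(4))
    have "F g v = ip p p"
      unfolding F_def ip_def Pg by (intro sum.cong) (auto simp: v(4))
    then have "m \<le> ip (w i (g i)) (P g v)" using optimal[OF g v(1) _ v(2)] pp by simp
    then show False using j m by (simp add: ipg) (simp add: g_def)
  qed
  then have "(\<Sum>k\<in>K. P f0 (U f0) k * P f0 (U f0) k) = 0" by (simp add: m_def F_def ip_def)
  then have "\<forall>k\<in>K. P f0 (U f0) k = 0"
    using assms(3) by (subst (asm) sum_nonneg_eq_0_iff) auto
  then show ?thesis using f0(1) U(1)[of f0]
    by (intro exI[of _ f0] exI[of _ "U f0"]) (auto simp: S_def P_def)
qed

text \<open>Sarkaria's tensor trick: for vectors \<open>v\<^sub>0, \<dots>, v\<^sub>r\<^sub>-\<^sub>1\<close> whose only linear dependency is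
  \<open>\<Sum>j. v\<^sub>j = 0\<close>, a colourful choice from the points \<open>x i \<otimes> v\<^sub>j\<close> is a Tverberg partition.\<close>

lemma conic_tverberg:
  fixes x :: "'i \<Rightarrow> 'k \<Rightarrow> real"
  assumes "finite I" "finite K" "r \<ge> 1" "(r - 1) * card K < card I"
  shows "\<exists>f u. f \<in> I \<rightarrow> {..<r} \<and> (\<forall>i\<in>I. 0 \<le> u i) \<and> sum u I = 1 \<and>
           (\<forall>j<r. \<forall>k\<in>K. (\<Sum>i | i \<in> I \<and> f i = j. u i * x i k) =
                          (\<Sum>i | i \<in> I \<and> f i = r - 1. u i * x i k))"
proof -
  \<comment> \<open>Sarkaria's vectors with coordinates \<open>l < r - 1\<close>: the unit vectors,
    followed by minus their sum at index \<open>r - 1\<close>. The tensors \<open>w i j\<close> thus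
    have \<open>(r - 1) * card K\<close> coordinates.\<close>
  define c :: "nat \<Rightarrow> nat \<Rightarrow> real" where
    "c j l = (if j = r - 1 then - 1 else if j = l then 1 else 0)" for j l
  define w where "w i j = (\<lambda>(l, k). x i k * c j l)" for i j
  have c0: "(\<Sum>j<r. c j l) = 0" if "l < r - 1" for l
  proof -
    have "{..<r} = insert (r - 1) {..<r - 1}" using assms(3) by auto
    moreover have "(\<Sum>j<r-1. c j l) = (\<Sum>j<r-1. if j = l then 1 else 0)"
      by (intro sum.cong) (auto simp: c_def)
    ultimately show ?thesis using that by (simp add: c_def)
  qed
  \<comment> \<open>For fixed \<open>i\<close> the tensors sum to zero over \<open>j\<close>, so
    their products with \<open>q\<close> cannot all be positive.\<close>
  have "\<exists>j\<in>{..<r}. (\<Sum>k\<in>{..<r-1} \<times> K. w i j k * q k) \<le> 0" for i q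
  proof (rule ccontr)
    assume "\<not> ?thesis"
    then have "\<And>j. j < r \<Longrightarrow> 0 < (\<Sum>k\<in>{..<r-1} \<times> K. w i j k * q k)" by force
    moreover have "{..<r} \<noteq> {}" using assms(3) by (simp add: lessThan_empty_iff)
    ultimately have "0 < (\<Sum>j<r. \<Sum>k\<in>{..<r-1} \<times> K. w i j k * q k)"
      by (intro sum_pos[where I = "{..<r}"]) simp_all
    also have "\<dots> = (\<Sum>(l,k)\<in>{..<r-1} \<times> K. (\<Sum>j<r. c j l) * (x i k * q (l, k)))"
      by (subst sum.swap) (auto simp: w_def sum_distrib_right sum_distrib_left mult_ac intro!: sum.cong)
    also have "\<dots> = 0" by (intro sum.neutral) (auto simp: c0)
    finally show False by simp
  qed
  then obtain f u where f: "f \<in> I \<rightarrow> {..<r}" and u: "\<forall>i\<in>I. 0 \<le> u i" "sum u I = 1"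
    and eq: "\<forall>k\<in>{..<r-1} \<times> K. (\<Sum>i\<in>I. u i * w i (f i) k) = 0"
    using colourful_caratheodory[of I "{..<r}" "{..<r-1} \<times> K" w] assms
    by (auto simp: card_cartesian_product)
  have "(\<Sum>i | i \<in> I \<and> f i = j. u i * x i k) = (\<Sum>i | i \<in> I \<and> f i = r - 1. u i * x i k)"
    if "j < r" "k \<in> K" for j k
  proof (cases "j = r - 1")
    case False
    then have "(\<Sum>i\<in>I. u i * w i (f i) (j, k)) = 0" using eq that by auto
    \<comment> \<open>Coordinate \<open>(j, k)\<close> only sees class \<open>j\<close>, with sign
      plus, and class \<open>r - 1\<close>, with sign minus.\<close>
    moreover have "(\<Sum>i\<in>I. u i * w i (f i) (j, k)) =
        (\<Sum>i\<in>I. (if f i = j then u i * x i k else 0) - (if f i = r - 1 then u i * x i k else 0))"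
      using False by (intro sum.cong) (auto simp: w_def c_def)
    ultimately show ?thesis
      using assms(1) by (simp add: sum_subtractf sum.inter_filter)
  qed simp
  then show ?thesis using f u by blast
qed

section \<open>Determinants of Gram matrices\<close>

lemma inner_matrix_transpose:
  fixes A :: "real^'n^'m"
  shows "x \<bullet> (A *v y) = (transpose A *v x) \<bullet> y"
  by (simp add: dot_lmul_matrix vector_transpose_matrix)

lemma gram_matrix_entry:
  fixes A :: "real^'n^'m"
  shows "(A ** transpose A) $ i $ j = A $ i \<bullet> A $ j"
  by (simp add: matrix_matrix_mult_def transpose_def inner_vec_def)

lemma inner_gram_matrix:
  fixes A :: "real^'n^'m"
  shows "x \<bullet> ((A ** transpose A) *v x) = (norm (transpose A *v x))\<^sup>2"
  by (simp add: matrix_vector_mul_assoc[symmetric] inner_matrix_transpose power2_norm_eq_inner)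

lemma inner_sum_gram_matrices:
  fixes A :: "'i \<Rightarrow> real^'n^'m"
  shows "x \<bullet> ((\<Sum>i\<in>J. u i *\<^sub>R (A i ** transpose (A i))) *v x) =
    (\<Sum>i\<in>J. u i * (norm (transpose (A i) *v x))\<^sup>2)"
proof -
  have lin: "linear (\<lambda>M :: real^'m^'m. x \<bullet> (M *v x))"
    by (rule linearI) (simp_all add: matrix_vector_mult_add_rdistrib inner_add_right
        scaleR_matrix_vector_assoc[symmetric])
  show ?thesis
    unfolding linear_sum[OF lin] linear_scale[OF lin] inner_gram_matrix by simp
qed

text \<open>Gram-Schmidt without normalisation: subtracting from a row its projection onto the
  earlier rows preserves the determinant and, by Pythagoras, does not lengthen the row. Zero rows
  are harmless since division by zero gives zero.\<close>

lemma exists_orthogonal_rows_same_det: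
  fixes A :: "real^'n^'n"
  shows "\<exists>B. (det B)\<^sup>2 = (det A)\<^sup>2 \<and> (\<forall>i. norm (B $ i) \<le> norm (A $ i)) \<and>
    (\<forall>i\<in>F. \<forall>j\<in>F. i \<noteq> j \<longrightarrow> B $ i \<bullet> B $ j = 0)"
  using finite_subset[OF subset_UNIV[of F] finite_class.finite_UNIV]
proof (induction F rule: finite_induct)
  case empty
  then show ?case by auto
next
  case (insert k F)
  then obtain B where B: "(det B)\<^sup>2 = (det A)\<^sup>2" "\<And>i. norm (B $ i) \<le> norm (A $ i)"
    "\<And>i j. i \<in> F \<Longrightarrow> j \<in> F \<Longrightarrow> i \<noteq> j \<Longrightarrow> B $ i \<bullet> B $ j = 0" by blast
  define x where "x = - (\<Sum>j\<in>F. ((B $ k \<bullet> B $ j) / (B $ j \<bullet> B $ j)) *\<^sub>R B $ j)"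
  define C where "C = (\<chi> i. if i = k then row k B + x else row i B)"
  have "x \<in> span {row j B |j. j \<noteq> k}"
    unfolding x_def using insert(2)
    by (intro span_neg span_sum span_scale span_base) (auto simp: row_def vec_eq_iff)
  then have "det C = det B"
    unfolding C_def by (intro det_row_span) (simp add: span_vec_eq)
  have Ck: "C $ k = B $ k + x" and Ci: "i \<noteq> k \<Longrightarrow> C $ i = B $ i" for i
    by (auto simp: C_def row_def vec_eq_iff)
  have orth: "C $ k \<bullet> B $ i = 0" if "i \<in> F" for i
  proof -
    have "x \<bullet> B $ i = - (\<Sum>j\<in>F. (B $ k \<bullet> B $ j) / (B $ j \<bullet> B $ j) * (B $ j \<bullet> B $ i))"
      by (simp add: x_def inner_sum_left)
    also have "(\<Sum>j\<in>F. (B $ k \<bullet> B $ j) / (B $ j \<bullet> B $ j) * (B $ j \<bullet> B $ i)) =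
        (\<Sum>j\<in>F. if j = i then B $ k \<bullet> B $ i else 0)"
      using that by (intro sum.cong) (auto simp: B(3))
    also have "\<dots> = B $ k \<bullet> B $ i" using that by simp
    finally show ?thesis by (simp add: Ck inner_add_left)
  qed
  then have "C $ k \<bullet> x = 0" by (simp add: x_def inner_sum_right)
  then have "(norm (B $ k))\<^sup>2 = (norm (C $ k))\<^sup>2 + (norm x)\<^sup>2"
    using norm_add_Pythagorean[of "C $ k" "- x"] by (simp add: Ck orthogonal_def)
  then have "(norm (C $ k))\<^sup>2 \<le> (norm (B $ k))\<^sup>2" by simp
  then have "norm (C $ k) \<le> norm (B $ k)" by (rule power2_le_imp_le) simp
  then have "norm (C $ i) \<le> norm (A $ i)" for i
    using B(2)[of i] Ci[of i] by (cases "i = k") auto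
  moreover have "C $ i \<bullet> C $ j = 0" if ij: "i \<in> insert k F" "j \<in> insert k F" "i \<noteq> j" for i j
  proof -
    consider "i = k" "j \<in> F" "j \<noteq> k" | "j = k" "i \<in> F" "i \<noteq> k" | "i \<in> F" "j \<in> F" "i \<noteq> k" "j \<noteq> k"
      using ij by blast
    then show ?thesis
      using ij(3) orth B(3) Ci by cases (simp_all add: inner_commute)
  qed
  ultimately show ?case using \<open>det C = det B\<close> B(1) by (intro exI[of _ C]) auto
qed

text \<open>For orthogonal rows the Gram matrix is diagonal, which gives equality; orthogonalising
  only shortens rows.\<close>

lemma hadamard_inequality:
  fixes A :: "real^'n^'n"
  shows "(det A)\<^sup>2 \<le> (\<Prod>i\<in>UNIV. (norm (A $ i))\<^sup>2)"
proof -
  obtain B where B: "(det B)\<^sup>2 = (det A)\<^sup>2" "\<And>i. norm (B $ i) \<le> norm (A $ i)"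
    "\<And>i j. i \<noteq> j \<Longrightarrow> B $ i \<bullet> B $ j = 0"
    using exists_orthogonal_rows_same_det[of A UNIV] by blast
  have "(det A)\<^sup>2 = det (B ** transpose B)"
    using B(1) by (simp add: det_mul det_transpose power2_eq_square)
  also have "\<dots> = (\<Prod>i\<in>UNIV. (B ** transpose B) $ i $ i)"
    by (intro det_diagonal) (simp add: gram_matrix_entry B(3))
  also have "\<dots> = (\<Prod>i\<in>UNIV. (norm (B $ i))\<^sup>2)"
    by (simp add: gram_matrix_entry power2_norm_eq_inner)
  also have "\<dots> \<le> (\<Prod>i\<in>UNIV. (norm (A $ i))\<^sup>2)"
    by (intro prod_mono) (simp add: B(2))
  finally show ?thesis .
qed

lemma trace_gram_matrix:
  fixes A :: "real^'n^'n"
  shows "trace (A ** transpose A) = (\<Sum>i\<in>UNIV. (norm (A $ i))\<^sup>2)"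
  by (simp add: trace_def gram_matrix_entry power2_norm_eq_inner)

text \<open>Hadamard's inequality followed by the inequality of arithmetic and geometric means for
  the squared row norms.\<close>

lemma det_le_trace_gram_matrix:
  fixes A :: "real^'n^'n"
  shows "(det A)\<^sup>2 \<le> (trace (A ** transpose A) / CARD('n)) ^ CARD('n)"
proof -
  let ?x = "\<lambda>i. (norm (A $ i))\<^sup>2" and ?d = "CARD('n)"
  have "(\<Prod>i\<in>UNIV. ?x i) powr (1 / ?d) \<le> (\<Sum>i\<in>UNIV. ?x i / ?d)"
    by (intro arith_geom_mean) auto
  then have "((\<Prod>i\<in>UNIV. ?x i) powr (1 / ?d)) ^ ?d \<le> (\<Sum>i\<in>UNIV. ?x i / ?d) ^ ?d"
    by (intro power_mono) auto
  moreover have "((\<Prod>i\<in>UNIV. ?x i) powr (1 / ?d)) ^ ?d = (\<Prod>i\<in>UNIV. ?x i)"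
  proof -
    have "(y powr (1 / ?d)) ^ ?d = y" if "y \<ge> 0" for y :: real
      using that by (cases "y = 0") (auto simp: powr_realpow[symmetric] powr_powr)
    then show ?thesis by (simp add: prod_nonneg)
  qed
  ultimately show ?thesis
    using hadamard_inequality[of A] by (simp add: trace_gram_matrix sum_divide_distrib)
qed

section \<open>Gram factorisation of positive definite matrices and Minkowski's inequality\<close>

text \<open>Gram-Schmidt for the inner product \<open>x \<bullet> (S *v y)\<close>: fewer than
  \<open>CARD('n)\<close> vectors do not span, so a vector outside their span can be projected and
  normalised.\<close>

lemma exists_orthonormal_family:
  fixes S :: "real^'n^'n" and F :: "'n set"
  assumes sym: "transpose S = S" and pos: "\<And>x. x \<noteq> 0 \<Longrightarrow> 0 < x \<bullet> (S *v x)"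
  shows "\<exists>u. \<forall>i\<in>F. \<forall>j\<in>F. u i \<bullet> (S *v u j) = (if i = j then 1 else 0)"
  using finite_subset[OF subset_UNIV[of F] finite_class.finite_UNIV]
proof (induction F rule: finite_induct)
  case empty
  then show ?case by auto
next
  case (insert k F)
  then obtain u where u: "\<And>i j. i \<in> F \<Longrightarrow> j \<in> F \<Longrightarrow> u i \<bullet> (S *v u j) = (if i = j then 1 else 0)" by blast
  have Scomm: "x \<bullet> (S *v y) = y \<bullet> (S *v x)" for x y
    by (metis inner_commute inner_matrix_transpose sym)
  have "dim (u ` F) \<le> card (u ` F)" by (intro dim_le_card') (simp add: insert(1))
  also have "\<dots> \<le> card F" by (simp add: insert(1) card_image_le)
  also have "\<dots> < CARD('n)" using insert(2) by (intro psubset_card_mono) auto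
  finally have "span (u ` F) \<noteq> UNIV"
    by (metis dim_UNIV dim_span DIM_cart DIM_real mult_1_right less_irrefl)
  then obtain v where v: "v \<notin> span (u ` F)" by blast
  define p where "p = (\<Sum>j\<in>F. (u j \<bullet> (S *v v)) *\<^sub>R u j)"
  define z where "z = v - p"
  have "p \<in> span (u ` F)" unfolding p_def by (intro span_sum span_scale span_base) auto
  then have "z \<noteq> 0" using v by (auto simp: z_def)
  define c where "c = z \<bullet> (S *v z)"
  have c: "c > 0" using pos[OF \<open>z \<noteq> 0\<close>] by (simp add: c_def)
  have zi: "u i \<bullet> (S *v z) = 0" if "i \<in> F" for i
  proof -
    have "u i \<bullet> (S *v p) = (\<Sum>j\<in>F. (u j \<bullet> (S *v v)) * (u i \<bullet> (S *v u j)))"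
      by (simp add: p_def Scomm[of "u i"] inner_sum_left)
    also have "\<dots> = (\<Sum>j\<in>F. if j = i then u i \<bullet> (S *v v) else 0)"
      using that by (intro sum.cong) (auto simp: u)
    also have "\<dots> = u i \<bullet> (S *v v)" using that by simp
    finally show ?thesis by (simp add: z_def matrix_vector_mult_diff_distrib inner_diff_right)
  qed
  define u' where "u' i = (if i = k then (1 / sqrt c) *\<^sub>R z else u i)" for i
  have "u' i \<bullet> (S *v u' j) = (if i = j then 1 else 0)" if "i \<in> insert k F" "j \<in> insert k F" for i j
    using that insert(2) c zi u
    by (auto simp: u'_def matrix_vector_mult_scaleR Scomm[of z "u _"] c_def[symmetric] real_div_sqrt field_simps)
  then show ?case by (intro exI[of _ u']) blast
qed

text \<open>With an \<open>S\<close>-orthonormal basis as the rows of \<open>U\<close>, the product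
  \<open>U ** S ** transpose U\<close> is the identity, and the inverse of \<open>U\<close> is the
  required factor.\<close>

lemma positive_definite_imp_gram_matrix:
  fixes S :: "real^'n^'n"
  assumes sym: "transpose S = S" and pos: "\<And>x. x \<noteq> 0 \<Longrightarrow> 0 < x \<bullet> (S *v x)"
  shows "\<exists>T :: real^'n^'n. invertible T \<and> S = T ** transpose T"
proof -
  obtain u :: "'n \<Rightarrow> real^'n" where u: "\<And>i j. u i \<bullet> (S *v u j) = (if i = j then 1 else 0)"
    using exists_orthonormal_family[of S UNIV] assms by auto
  define U :: "real^'n^'n" where "U = (\<chi> i. u i)"
  have "(U ** S ** transpose U) $ i $ j = mat 1 $ i $ j" for i j
  proof -
    have "(U ** S ** transpose U) $ i $ j = u i \<bullet> (S *v u j)"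
      unfolding matrix_mul_assoc[symmetric]
      by (simp add: U_def matrix_matrix_mult_def transpose_def matrix_vector_mult_def inner_vec_def)
    then show ?thesis by (simp add: u mat_def)
  qed
  then have USU: "U ** S ** transpose U = mat 1" by (simp add: vec_eq_iff)
  then have inv: "invertible U"
    by (metis invertible_right_inverse matrix_mul_assoc)
  then obtain V where V: "U ** V = mat 1" "V ** U = mat 1" by (auto simp: invertible_def)
  have Vt: "transpose U ** transpose V = mat 1"
    by (metis V(2) matrix_transpose_mul transpose_mat)
  have "S = (V ** U) ** S ** (transpose U ** transpose V)" by (simp add: V Vt)
  also have "\<dots> = V ** (U ** S ** transpose U) ** transpose V" by (simp add: matrix_mul_assoc)
  finally have "S = V ** transpose V" by (simp add: USU)
  moreover have "invertible V" using V by (auto simp: invertible_def)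
  ultimately show ?thesis by blast
qed

text \<open>Minkowski's determinant inequality for matrices of equal determinant: with \<open>T ** transpose T\<close>
  the combined matrix, the inequality of arithmetic and geometric means bounds each
  \<open>trace (T\<inverse> ** M i ** transpose T\<inverse>)\<close> from below, and these traces average to the dimension.\<close>

lemma det_convex_combination_gram_matrices:
  fixes A :: "'i \<Rightarrow> real^'n^'n" and T :: "real^'n^'n"
  assumes "finite J" "invertible T" "\<And>i. i \<in> J \<Longrightarrow> 0 \<le> u i"
    and det: "\<And>i. i \<in> J \<Longrightarrow> \<bar>det (A i)\<bar> = \<delta>" and "\<delta> \<ge> 0"
    and T: "T ** transpose T = (\<Sum>i\<in>J. u i *\<^sub>R (A i ** transpose (A i)))"
  shows "\<delta>\<^sup>2 * sum u J ^ CARD('n) \<le> (det T)\<^sup>2"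
proof -
  let ?d = "CARD('n)"
  obtain V where V: "T ** V = mat 1" "V ** T = mat 1" using assms(2) by (auto simp: invertible_def)
  have Vt: "transpose T ** transpose V = mat 1"
    by (metis V(2) matrix_transpose_mul transpose_mat)
  define q where "q i = trace ((V ** A i) ** transpose (V ** A i))" for i
  \<comment> \<open>The factors \<open>V ** A i\<close> all have the same squared determinant;
    \<open>\<rho>\<close> is its root of order \<open>?d\<close>, the lower bound for each
    \<open>q i / ?d\<close>.\<close>
  define \<rho> where "\<rho> = root ?d ((\<delta> * det V)\<^sup>2)"
  have \<rho>: "\<rho> \<ge> 0" "\<rho> ^ ?d = (\<delta> * det V)\<^sup>2"
    by (auto simp: \<rho>_def)
  have q: "?d * \<rho> \<le> q i" if "i \<in> J" for i
  proof -
    have "\<rho> ^ ?d = (det (V ** A i))\<^sup>2"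
      using det[OF that] by (auto simp: \<rho> det_mul power_mult_distrib)
    also have "\<dots> \<le> (q i / ?d) ^ ?d" unfolding q_def by (rule det_le_trace_gram_matrix)
    finally have "\<rho> \<le> q i / ?d"
      by (rule power_le_imp_le_base[where n = "?d - 1", simplified]) (auto simp: q_def trace_gram_matrix sum_nonneg)
    then show ?thesis by (simp add: field_simps)
  qed
  have "(\<Sum>i\<in>J. u i * q i) = trace (V ** (\<Sum>i\<in>J. u i *\<^sub>R (A i ** transpose (A i))) ** transpose V)"
  proof -
    have lin: "linear (\<lambda>M. trace (V ** M ** transpose V))"
      by (rule linearI) (simp_all add: trace_def matrix_matrix_mult_def sum.distrib sum_distrib_left
          sum_distrib_right algebra_simps)
    show ?thesis
      unfolding linear_sum[OF lin] linear_scale[OF lin] q_def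
      by (simp add: matrix_transpose_mul matrix_mul_assoc)
  qed
  also have "\<dots> = trace ((V ** T) ** (transpose T ** transpose V))"
    by (simp add: T[symmetric] matrix_mul_assoc)
  also have "\<dots> = ?d" by (simp add: V Vt trace_I)
  finally have "(\<Sum>i\<in>J. u i * q i) = ?d" .
  moreover have "(\<Sum>i\<in>J. u i * (?d * \<rho>)) \<le> (\<Sum>i\<in>J. u i * q i)"
    by (intro sum_mono mult_left_mono q assms(3))
  moreover have "(\<Sum>i\<in>J. u i * (?d * \<rho>)) = ?d * (sum u J * \<rho>)"
    by (simp add: sum_distrib_right sum_distrib_left mult_ac)
  ultimately have "?d * (sum u J * \<rho>) \<le> ?d * 1"
    by linarith
  then have "sum u J * \<rho> \<le> 1" by (simp add: mult_le_cancel_left)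
  then have "(sum u J * \<rho>) ^ ?d \<le> 1"
    using assms(3) \<rho> by (intro power_le_one) (auto intro!: mult_nonneg_nonneg sum_nonneg)
  then have "sum u J ^ ?d * \<delta>\<^sup>2 * (det V)\<^sup>2 \<le> 1"
    by (simp add: power_mult_distrib \<rho> mult_ac)
  then have "(sum u J ^ ?d * \<delta>\<^sup>2 * (det V)\<^sup>2) * (det T)\<^sup>2 \<le> 1 * (det T)\<^sup>2"
    by (intro mult_right_mono) auto
  moreover have "det V * det T = 1" by (metis V(2) det_I det_mul)
  then have "(det V)\<^sup>2 * (det T)\<^sup>2 = 1" by (simp add: power_mult_distrib[symmetric])
  ultimately show ?thesis by (simp add: mult.assoc) (simp add: mult.commute)
qed

section \<open>Volumes of linear images\<close>

text \<open>The library has the volume formula for linear images only for well-ordered index types;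
  the following copy of the index type \<open>'n\<close> is one.\<close>

typedef (overloaded) 'n ordered_index = "{..<CARD('n::finite)}"
  by (rule exI[of _ 0]) simp

setup_lifting type_definition_ordered_index

instantiation ordered_index :: (finite) linorder
begin
lift_definition less_eq_ordered_index :: "'a ordered_index \<Rightarrow> 'a ordered_index \<Rightarrow> bool" is "(\<le>)" .
lift_definition less_ordered_index :: "'a ordered_index \<Rightarrow> 'a ordered_index \<Rightarrow> bool" is "(<)" .
instance by standard (transfer; auto)+
end

lemma bij_betw_Rep_ordered_index:
  "bij_betw Rep_ordered_index (UNIV :: 'n::finite ordered_index set) {..<CARD('n)}"
  by (simp add: bij_betw_def inj_on_def Rep_ordered_index_inject type_definition.Rep_range[OF type_definition_ordered_index])

instance ordered_index :: (finite) finite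
  by standard (metis bij_betw_Rep_ordered_index bij_betw_finite finite_lessThan)

instance ordered_index :: (finite) wellorder
proof
  fix P :: "'a ordered_index \<Rightarrow> bool" and a
  assume step: "\<And>x. (\<And>y. y < x \<Longrightarrow> P y) \<Longrightarrow> P x"
  show "P a"
    by (induction a rule: measure_induct_rule[of Rep_ordered_index])
      (auto intro: step simp: less_ordered_index.rep_eq)
qed

lemma exists_bij_ordered_index: "\<exists>g :: 'n::finite ordered_index \<Rightarrow> 'n. bij g"
  using bij_betw_same_card[OF bij_betw_Rep_ordered_index]
  by (intro finite_same_card_bij) auto

text \<open>Conjugation by \<open>g\<close> is a sign-preserving bijection between the permutations
  of the two index types and matches the terms of the Leibniz formula.\<close>

lemma det_reindex:
  fixes A :: "'a::comm_ring_1^'n^'n" and g :: "'m::finite \<Rightarrow> 'n"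
  assumes "bij g"
  shows "det (\<chi> i j. A $ g i $ g j) = det A"
proof -
  have inv: "map_permutation UNIV (inv g) (map_permutation UNIV g p) = p"
    if "p permutes UNIV" for p :: "'m \<Rightarrow> 'm"
    using assms that by (intro map_permutation_compose_inv) (auto simp: bij_is_inj)
  have inv': "map_permutation UNIV g (map_permutation UNIV (inv g) p) = p"
    if "p permutes UNIV" for p :: "'n \<Rightarrow> 'n"
    using assms that by (intro map_permutation_compose_inv) (auto simp: bij_imp_bij_inv surj_f_inv_f bij_is_surj)
  have "det (\<chi> i j. A $ g i $ g j) =
      (\<Sum>p | p permutes (UNIV :: 'm set). of_int (sign p) * (\<Prod>i\<in>UNIV. A $ g i $ g (p i)))"
    by (simp add: det_def)
  also have "\<dots> = det A"
    unfolding det_def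
  proof (rule sum.reindex_bij_witness[where i = "map_permutation UNIV (inv g)"
        and j = "map_permutation UNIV g"], goal_cases)
    case (2 p)
    then show ?case using map_permutation_permutes[OF assms] by simp
  next
    case (4 p)
    then show ?case using map_permutation_permutes[OF bij_imp_bij_inv[OF assms]] by simp
  next
    case (5 p)
    then have p: "p permutes UNIV" by simp
    have "(\<Prod>i\<in>UNIV. A $ i $ map_permutation UNIV g p i) = (\<Prod>i\<in>UNIV. A $ g i $ map_permutation UNIV g p (g i))"
      by (rule prod.reindex_bij_betw[OF assms, symmetric])
    also have "\<dots> = (\<Prod>i\<in>UNIV. A $ g i $ g (p i))"
      using assms by (simp add: map_permutation_apply bij_is_inj)
    finally show ?case
      using sign_map_permutation[of g UNIV p] assms p by (simp add: bij_is_inj)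
  qed (auto simp: inv inv')
  finally show ?thesis .
qed

lemma prod_inner_Basis_cart:
  fixes x :: "real^'n"
  shows "(\<Prod>b\<in>Basis. x \<bullet> b) = (\<Prod>i\<in>UNIV. x $ i)"
proof -
  have Basis: "(Basis :: (real^'n) set) = range (\<lambda>i. axis i 1)" by (auto simp: Basis_vec_def)
  show ?thesis
    unfolding Basis by (subst prod.reindex) (auto simp: inj_on_def axis_eq_axis inner_axis)
qed

text \<open>Renaming coordinates carries boxes to boxes with the same side lengths, and these
  volumes determine the measure.\<close>

lemma lborel_reindex:
  fixes g :: "'m::finite \<Rightarrow> 'n::finite"
  assumes "bij g"
  defines "R \<equiv> \<lambda>x :: real^'n. \<chi> i. x $ g i"
  shows "lborel = distr lborel borel R"
proof (rule lborel_eqI)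
  define Q :: "real^'m \<Rightarrow> real^'n" where "Q y = (\<chi> j. y $ inv g j)" for y
  have gi: "inv g (g i) = i" "g (inv g j) = j" for i j
    using assms(1) by (simp_all add: bij_is_inj bij_is_surj surj_f_inv_f)
  have contR: "continuous_on UNIV R"
    unfolding R_def by (intro continuous_intros)
  have [measurable]: "R \<in> borel_measurable borel"
    by (intro borel_measurable_continuous_onI contR)
  fix l u :: "real^'m" assume lu: "\<And>b. b \<in> Basis \<Longrightarrow> l \<bullet> b \<le> u \<bullet> b"
  have lu': "l $ i \<le> u $ i" for i
    using lu[of "axis i 1"] by (simp add: inner_axis axis_in_Basis_iff)
  have "R -` box l u = box (Q l) (Q u)"
    unfolding mem_box_cart set_eq_iff vimage_eq R_def Q_def by (auto simp: gi) (metis gi)+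
  then have "emeasure (distr lborel borel R) (box l u) = emeasure lborel (box (Q l) (Q u))"
    by (subst emeasure_distr) auto
  also have "\<dots> = (\<Prod>b\<in>Basis. (Q u - Q l) \<bullet> b)"
    using lu' by (intro emeasure_lborel_box) (auto simp: Basis_vec_def inner_axis Q_def)
  also have "(\<Prod>b\<in>Basis. (Q u - Q l) \<bullet> b) = (\<Prod>j\<in>UNIV. (Q u - Q l) $ j)"
    by (simp only: prod_inner_Basis_cart)
  also have "\<dots> = (\<Prod>i\<in>UNIV. (Q u - Q l) $ g i)"
    by (rule prod.reindex_bij_betw[OF assms(1), symmetric])
  also have "\<dots> = (\<Prod>i\<in>UNIV. (u - l) $ i)" by (simp add: Q_def gi)
  also have "\<dots> = (\<Prod>b\<in>Basis. (u - l) \<bullet> b)"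
    by (simp only: prod_inner_Basis_cart)
  finally show "emeasure (distr lborel borel R) (box l u) = (\<Prod>b\<in>Basis. (u - l) \<bullet> b)" .
qed simp

lemma measure_reindex:
  fixes g :: "'m::finite \<Rightarrow> 'n::finite"
  assumes "bij g" "compact S"
  shows "measure lebesgue ((\<lambda>x :: real^'n. \<chi> i. x $ g i) ` S) = measure lebesgue S"
proof -
  define R :: "real^'n \<Rightarrow> real^'m" where "R x = (\<chi> i. x $ g i)" for x
  have contR: "continuous_on T R" for T
    unfolding R_def by (intro continuous_intros)
  have [measurable]: "R \<in> borel_measurable borel"
    by (intro borel_measurable_continuous_onI contR)
  have "inj R"
    by (rule injI) (metis (no_types, lifting) R_def assms(1) bij_pointE vec_eq_iff vec_lambda_beta)
  have "compact (R ` S)" by (intro compact_continuous_image contR assms)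
  then have sets: "R ` S \<in> sets borel" "S \<in> sets borel" using assms(2) by (auto intro: borel_compact)
  have "measure lebesgue (R ` S) = measure (distr lborel borel R) (R ` S)"
    using lborel_reindex[OF assms(1)] sets by (simp add: R_def[abs_def] measure_completion)
  also have "\<dots> = measure lborel (R -` (R ` S))"
    using sets by (subst measure_distr) auto
  also have "\<dots> = measure lebesgue S"
    using sets \<open>inj R\<close> by (simp add: inj_vimage_image_eq measure_completion)
  finally show ?thesis by (simp add: R_def)
qed

text \<open>Renaming coordinates by \<open>R\<close> turns \<open>A\<close> into the matrix
  \<open>B\<close> over a well-ordered index type, preserving volumes and the determinant, so the
  formula there carries over.\<close>

lemma measure_matrix_image:
  fixes A :: "real^'n^'n"
  assumes "compact S"
  shows "measure lebesgue ((*v) A ` S) = \<bar>det A\<bar> * measure lebesgue S"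
proof -
  obtain g :: "'n ordered_index \<Rightarrow> 'n" where g: "bij g" using exists_bij_ordered_index by blast
  define R :: "real^'n \<Rightarrow> real^'n ordered_index" where "R x = (\<chi> i. x $ g i)" for x
  define B where "B = (\<chi> i j. A $ g i $ g j)"
  have contR: "continuous_on T R" for T
    unfolding R_def by (intro continuous_intros)
  have BR: "B *v R x = R (A *v x)" for x
    unfolding B_def R_def matrix_vector_mult_def
    by (simp add: vec_eq_iff sum.reindex_bij_betw[OF g, where g = "\<lambda>j. A $ g _ $ j * x $ j"])
  have cpt: "compact ((*v) A ` S)" "compact (R ` S)"
    by (auto intro!: compact_continuous_image assms contR matrix_vector_mult_linear_continuous_on)
  have "measure lebesgue ((*v) A ` S) = measure lebesgue (R ` (*v) A ` S)"
    using measure_reindex[OF g cpt(1)] by (simp add: R_def[abs_def])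
  also have "R ` (*v) A ` S = (*v) B ` R ` S" by (auto simp: image_image BR)
  also have "measure lebesgue \<dots> = \<bar>det (matrix ((*v) B))\<bar> * measure lebesgue (R ` S)"
    using cpt by (intro measure_linear_image) (auto intro: lmeasurable_compact)
  also have "\<dots> = \<bar>det A\<bar> * measure lebesgue S"
    using measure_reindex[OF g assms] det_reindex[OF g, of A] by (simp add: R_def[abs_def] B_def)
  finally show ?thesis .
qed

section \<open>Ellipsoids\<close>

lemma centered_ellipsoid_iff_matrix_image:
  fixes E :: "(real^'n) set"
  shows "ellipsoid E \<and> centered_at_origin E \<longleftrightarrow>
    (\<exists>A :: real^'n^'n. invertible A \<and> E = (*v) A ` cball 0 1)"
proof
  assume "ellipsoid E \<and> centered_at_origin E"
  then obtain L :: "real^'n \<Rightarrow> real^'n" and c where L: "linear L" "bij L" and E: "E = (\<lambda>x. c + L x) ` cball 0 1"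
    and sym: "uminus ` E = E"
    unfolding ellipsoid_def centered_at_origin_def by blast
  have "c = 0"
  proof (rule ccontr)
    assume "c \<noteq> 0"
    \<comment> \<open>The point of \<open>E\<close> farthest out in the direction of
      \<open>c\<close> is \<open>c + L (y / norm y)\<close>. Its negative could only come from a
      \<open>z\<close> of norm \<open>2 * norm y + 1\<close>, outside the unit ball.\<close>
    obtain y where y: "L y = c" using L(2) by (metis bij_pointE)
    then have "y \<noteq> 0" using \<open>c \<noteq> 0\<close> linear_0[OF L(1)] by auto
    have "c + L ((1 / norm y) *\<^sub>R y) \<in> E"
      unfolding E using \<open>y \<noteq> 0\<close> by (intro imageI) simp
    then have "- (c + L ((1 / norm y) *\<^sub>R y)) \<in> E" using sym by blast
    then obtain z where z: "norm z \<le> 1" "- (c + L ((1 / norm y) *\<^sub>R y)) = c + L z"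
      unfolding E by auto
    then have "L z = - (c + L ((1 / norm y) *\<^sub>R y)) - c"
      by (metis add_diff_cancel_left')
    also have "\<dots> = - (c + c + (1 / norm y) *\<^sub>R c)"
      by (simp add: linear_scale[OF L(1)] y)
    also have "\<dots> = (- (2 + 1 / norm y)) *\<^sub>R c"
      by (simp only: scaleR_minus_left scaleR_left_distrib scaleR_2)
    also have "\<dots> = L ((- (2 + 1 / norm y)) *\<^sub>R y)"
      by (simp only: linear_scale[OF L(1)] y)
    finally have "L z = L ((- (2 + 1 / norm y)) *\<^sub>R y)" .
    then have "z = (- (2 + 1 / norm y)) *\<^sub>R y" using L(2) by (simp add: bij_is_inj inj_eq)
    then have "norm z = \<bar>2 + 1 / norm y\<bar> * norm y" by (simp only: norm_scaleR abs_minus_cancel)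
    also have "\<dots> = 2 * norm y + 1" using \<open>y \<noteq> 0\<close> by (simp add: field_simps)
    finally show False using z(1) \<open>y \<noteq> 0\<close> by simp
  qed
  moreover have "invertible (matrix L)"
    using L by (simp add: invertible_det_nz det_nz_iff_inj bij_is_inj)
  ultimately show "\<exists>A :: real^'n^'n. invertible A \<and> E = (*v) A ` cball 0 1"
    using E by (intro exI[of _ "matrix L"]) (simp add: L(1))
next
  assume "\<exists>A :: real^'n^'n. invertible A \<and> E = (*v) A ` cball 0 1"
  then obtain A :: "real^'n^'n" where A: "invertible A" and E: "E = (*v) A ` cball 0 1" by blast
  have "inj ((*v) A)" using A by (simp add: inj_matrix_vector_mult)
  then have "bij ((*v) A)"
    by (simp add: bij_def linear_injective_imp_surjective)
  then have "ellipsoid E"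
    unfolding ellipsoid_def E by (intro exI[of _ "(*v) A"] exI[of _ 0]) auto
  moreover have "- x \<in> E" if x: "x \<in> E" for x
  proof -
    obtain y where "norm y \<le> 1" "x = A *v y" using x by (auto simp: E)
    then have "norm (- y) \<le> 1" "- x = A *v (- y)" by (simp_all add: vec.neg)
    then show ?thesis unfolding E by (intro image_eqI[of _ _ "- y"]) simp_all
  qed
  then have "centered_at_origin E"
    unfolding centered_at_origin_def by (force simp: image_iff)
  ultimately show "ellipsoid E \<and> centered_at_origin E" ..
qed

text \<open>Counts the independent entries of a symmetric matrix; the enumeration \<open>h\<close>
  supplies an order on the index type.\<close>

lemma card_lower_triangle:
  fixes h :: "'n::finite \<Rightarrow> nat"
  assumes "bij_betw h UNIV {0..<CARD('n)}"
  shows "card {(a, b). h b \<le> h a} = CARD('n) * (CARD('n) + 1) div 2"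
proof -
  define n where "n = CARD('n)"
  have inj: "inj h" and h: "range h = {0..<n}" using assms by (auto simp: bij_betw_def n_def)
  have "card {(a, b). h b \<le> h a} = card (map_prod h h ` {(a, b). h b \<le> h a})"
    using inj by (intro card_image[symmetric]) (auto simp: inj_on_def)
  also have "map_prod h h ` {(a, b). h b \<le> h a} = (SIGMA x:{0..<n}. {0..x})"
  proof (intro subset_antisym subsetI)
    fix p assume "p \<in> map_prod h h ` {(a, b). h b \<le> h a}"
    then obtain a b where "p = (h a, h b)" "h b \<le> h a" by auto
    moreover have "h a \<in> {0..<n}" using h by blast
    ultimately show "p \<in> (SIGMA x:{0..<n}. {0..x})" by simp
  next
    fix p assume "p \<in> (SIGMA x:{0..<n}. {0..x})"
    then obtain x y where p: "p = (x, y)" "x < n" "y \<le> x" by auto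
    then have "x \<in> range h" "y \<in> range h" unfolding h by auto
    then obtain a b where "x = h a" "y = h b" by blast
    then show "p \<in> map_prod h h ` {(a, b). h b \<le> h a}"
      using p by (intro image_eqI[of _ _ "(a, b)"]) auto
  qed
  also have "card \<dots> = (\<Sum>x=0..<n. Suc x)" by simp
  also have "\<dots> = n * (n + 1) div 2" by (induction n) auto
  finally show ?thesis by (simp add: n_def)
qed

text \<open>Compares support functions. A point outside the hull is cut off by a direction
  \<open>a\<close>, yet the squared support function of the image under \<open>T\<close> is the
  \<open>u\<close>-weighted sum of those of the given ellipsoids; \<open>s\<close> compensates for
  the total weight.\<close>

lemma ellipsoid_subset_convex_hull:
  fixes A :: "'i \<Rightarrow> real^'n^'n" and T :: "real^'n^'n"
  assumes "finite J" "J \<noteq> {}" and u: "\<And>i. i \<in> J \<Longrightarrow> 0 \<le> u i"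
    and s: "0 \<le> s" "s\<^sup>2 * sum u J \<le> 1"
    and T: "T ** transpose T = (\<Sum>i\<in>J. u i *\<^sub>R (A i ** transpose (A i)))"
  shows "(*v) (s *\<^sub>R T) ` cball 0 1 \<subseteq> convex hull (\<Union>i\<in>J. (*v) (A i) ` cball 0 1)"
proof (rule ccontr)
  define H where "H = convex hull (\<Union>i\<in>J. (*v) (A i) ` cball 0 1)"
  assume "\<not> ?thesis"
  then obtain y where y: "norm y \<le> 1" "(s *\<^sub>R T) *v y \<notin> H"
    by (fastforce simp: H_def)
  have "compact H" unfolding H_def
    by (intro compact_convex_hull compact_UN assms compact_continuous_image
        matrix_vector_mult_linear_continuous_on compact_cball)
  then obtain a b where ab: "a \<bullet> ((s *\<^sub>R T) *v y) < b" "\<And>z. z \<in> H \<Longrightarrow> b < a \<bullet> z"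
    using separating_hyperplane_closed_point[of H "(s *\<^sub>R T) *v y"] y(2)
    by (auto simp: H_def compact_imp_closed)
  have b: "norm (transpose (A i) *v a) < - b" if "i \<in> J" for i
  proof -
    define v where "v = transpose (A i) *v a"
    \<comment> \<open>The point of the unit ball minimising \<open>a \<bullet> (A i *v w)\<close>;
      for \<open>v = 0\<close> it is 0.\<close>
    define w where "w = (- (1 / norm v)) *\<^sub>R v"
    have "norm w \<le> 1" by (simp add: w_def)
    then have "A i *v w \<in> H" unfolding H_def using that by (intro hull_inc UN_I[of i]) auto
    then have "b < a \<bullet> (A i *v w)" by (rule ab(2))
    also have "\<dots> = - norm v"
      unfolding inner_matrix_transpose v_def[symmetric] w_def
      by (simp add: dot_square_norm power2_eq_square)
    finally show ?thesis by (simp add: v_def)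
  qed
  obtain i where "i \<in> J" using assms(2) by blast
  from b[OF this] have "b < 0" by (smt (verit) norm_ge_zero)
  have "(norm (transpose T *v a))\<^sup>2 = a \<bullet> ((\<Sum>i\<in>J. u i *\<^sub>R (A i ** transpose (A i))) *v a)"
    unfolding T[symmetric] inner_gram_matrix ..
  also have "\<dots> = (\<Sum>i\<in>J. u i * (norm (transpose (A i) *v a))\<^sup>2)"
    by (rule inner_sum_gram_matrices)
  also have "\<dots> \<le> (\<Sum>i\<in>J. u i * b\<^sup>2)"
    using b by (intro sum_mono mult_left_mono u) (auto simp: abs_le_square_iff[symmetric] less_imp_le abs_of_neg \<open>b < 0\<close>)
  finally have "(s * norm (transpose T *v a))\<^sup>2 \<le> s\<^sup>2 * (sum u J * b\<^sup>2)"
    by (simp add: power_mult_distrib mult_left_mono sum_distrib_right)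
  also have "\<dots> \<le> (- b)\<^sup>2"
    using mult_right_mono[OF s(2), of "b\<^sup>2"] by (simp add: mult.assoc)
  finally have le: "s * norm (transpose T *v a) \<le> - b"
    by (rule power2_le_imp_le) (use \<open>b < 0\<close> in simp)
  have "a \<bullet> ((s *\<^sub>R T) *v y) = s * ((transpose T *v a) \<bullet> y)"
    by (simp add: scaleR_matrix_vector_assoc[symmetric] inner_matrix_transpose)
  moreover have "\<bar>(transpose T *v a) \<bullet> y\<bar> \<le> norm (transpose T *v a) * 1"
    by (rule order_trans[OF Cauchy_Schwarz_ineq2]) (intro mult_left_mono y, simp)
  then have "s * ((transpose T *v a) \<bullet> y) \<ge> - (s * norm (transpose T *v a))"
    using mult_left_mono[of "- norm (transpose T *v a)" "(transpose T *v a) \<bullet> y" s] s(1) by auto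
  ultimately show False using le ab(1) by linarith
qed

section \<open>The Tverberg partition and the common ellipsoid\<close>

theorem theorem4p4:
  fixes r :: nat and I :: "'i set" and E :: "'i \<Rightarrow> (real ^ 'n) set"
  assumes "r \<ge> 1"
    and "finite I"
    and "card I = (r - 1) * (CARD('n) * (CARD('n) + 1) div 2) + 1"
    and "\<And>i. i \<in> I \<Longrightarrow> ellipsoid (E i)"
    and "\<And>i. i \<in> I \<Longrightarrow> centered_at_origin (E i)"
    and "\<And>i. i \<in> I \<Longrightarrow> measure lebesgue (E i) = 1"
  shows "\<exists>P. partition_on I P \<and> card P = r \<and>
    (\<exists>G. ellipsoid G \<and> centered_at_origin G \<and> measure lebesgue G = 1 \<and>
         G \<subseteq> (\<Inter>A\<in>P. convex hull (\<Union>i\<in>A. E i)))"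
proof -
  let ?d = "CARD('n)" and ?B = "cball 0 1 :: (real^'n) set"
  have "\<forall>i\<in>I. \<exists>A :: real^'n^'n. invertible A \<and> E i = (*v) A ` ?B"
    using assms(4,5) centered_ellipsoid_iff_matrix_image by blast
  then obtain A :: "'i \<Rightarrow> real^'n^'n" where A: "\<And>i. i \<in> I \<Longrightarrow> invertible (A i)" "\<And>i. i \<in> I \<Longrightarrow> E i = (*v) (A i) ` ?B"
    by metis
  define M where "M i = A i ** transpose (A i)" for i
  define \<beta> where "\<beta> = measure lebesgue ?B"
  \<comment> \<open>Equal volumes mean equal determinants up to sign, as the determinant inequality
    requires.\<close>
  have det_A: "\<bar>det (A i)\<bar> * \<beta> = 1" if "i \<in> I" for i
    using assms(6)[OF that] measure_matrix_image[of ?B "A i"] A(2)[OF that] by (simp add: \<beta>_def)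
  have "I \<noteq> {}" using assms(3) by auto
  then have "\<beta> > 0"
    using det_A by (metis \<beta>_def ex_in_conv less_eq_real_def measure_nonneg mult_zero_right zero_neq_one)

  obtain h :: "'n \<Rightarrow> nat" where h: "bij_betw h UNIV {0..<?d}"
    using ex_bij_betw_finite_nat[of "UNIV :: 'n set"] by auto
  \<comment> \<open>Symmetric matrices are determined by their lower triangle, so these entries
    serve as coordinates.\<close>
  let ?K = "{(a, b). h b \<le> h a}"
  have "(r - 1) * card ?K < card I"
    unfolding card_lower_triangle[OF h] using assms(3) by linarith
  then obtain f u where f: "f \<in> I \<rightarrow> {..<r}" and u: "\<forall>i\<in>I. 0 \<le> u i" "sum u I = 1"
    and eq: "\<forall>j<r. \<forall>k\<in>?K. (\<Sum>i | i \<in> I \<and> f i = j. u i * M i $ fst k $ snd k) =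
      (\<Sum>i | i \<in> I \<and> f i = r - 1. u i * M i $ fst k $ snd k)"
    using conic_tverberg[OF assms(2) finite_class.finite assms(1), of ?K "\<lambda>i k. M i $ fst k $ snd k"]
    by blast
  have tverberg: "(\<Sum>i | i \<in> I \<and> f i = j. u i * M i $ a $ b) =
      (\<Sum>i | i \<in> I \<and> f i = r - 1. u i * M i $ a $ b)" if "j < r" "h b \<le> h a" for j a b
    using eq[rule_format, of j "(a, b)"] that by simp
  define J where "J j = {i \<in> I. f i = j}" for j
  define S where "S = (\<Sum>i\<in>J (r - 1). u i *\<^sub>R M i)"
  have fin_J: "finite (J j)" for j using assms(2) by (simp add: J_def)
  have u_J: "0 \<le> u i" if "i \<in> J j" for i j using u that by (simp add: J_def)
  have M_sym: "M i $ a $ b = M i $ b $ a" for i a b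
    by (simp add: M_def gram_matrix_entry inner_commute)
  have S_eq: "(\<Sum>i\<in>J j. u i *\<^sub>R M i) = S" if "j < r" for j
  proof -
    have "(\<Sum>i\<in>J j. u i * M i $ a $ b) = (\<Sum>i\<in>J (r - 1). u i * M i $ a $ b)" for a b
    proof (cases "h b \<le> h a")
      case False
      then show ?thesis
        unfolding M_sym[of _ a b] J_def by (intro tverberg that) simp
    qed (simp add: tverberg that J_def)
    then show ?thesis by (simp add: S_def vec_eq_iff)
  qed
  have quad: "x \<bullet> (S *v x) = (\<Sum>i\<in>J j. u i * (norm (transpose (A i) *v x))\<^sup>2)" if "j < r" for x j
    unfolding S_eq[OF that, symmetric] M_def by (rule inner_sum_gram_matrices)
  \<comment> \<open>Some weight is positive, and the class containing that index also represents
    \<open>S\<close>; its invertible \<open>A i\<close> makes the form definite.\<close>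
  have S_pos: "0 < x \<bullet> (S *v x)" if "x \<noteq> 0" for x
  proof -
    obtain i where i: "i \<in> I" "u i > 0"
      using u by (metis less_eq_real_def sum.neutral zero_neq_one)
    then have fi: "f i < r" "i \<in> J (f i)" using f by (auto simp: J_def)
    have "transpose (A i) *v x \<noteq> 0"
      using inj_matrix_vector_mult[OF transpose_invertible[OF A(1)[OF i(1)]]] that
      by (metis injD matrix_vector_mult_0_right)
    then show ?thesis
      unfolding quad[OF fi(1)] using fi(2) i u_J
      by (intro sum_pos2[OF fin_J fi(2)]) (auto intro!: mult_nonneg_nonneg)
  qed
  have "transpose S = S"
    using M_sym by (simp add: S_def transpose_def vec_eq_iff)
  then obtain T :: "real^'n^'n" where T: "invertible T" "S = T ** transpose T"
    using positive_definite_imp_gram_matrix[of S] S_pos by blast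

  \<comment> \<open>An empty class would force \<open>S = 0\<close>. Nonempty disjoint classes are
    distinct, which gives exactly \<open>r\<close> parts.\<close>
  have J_ne: "J j \<noteq> {}" if "j < r" for j
    using quad[OF that, of 1] S_pos[of 1] by auto
  define P where "P = J ` {..<r}"
  have "partition_on I P"
    using J_ne f by (intro partition_onI) (auto simp: P_def J_def disjnt_def)
  moreover have "inj_on J {..<r}"
    using J_ne by (fastforce simp: inj_on_def J_def)
  then have "card P = r" by (simp add: P_def card_image)
  moreover
  \<comment> \<open>Scaling chosen so that the image of the unit ball under
    \<open>s *\<^sub>R T\<close> has volume one.\<close>
  define s where "s = root ?d (1 / (\<beta> * \<bar>det T\<bar>))"
  have "det T \<noteq> 0" using T(1) by (simp add: invertible_det_nz)
  then have s: "0 < s" "s ^ ?d * (\<bar>det T\<bar> * \<beta>) = 1"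
    using \<open>\<beta> > 0\<close> by (auto simp: s_def)
  define G where "G = (*v) (s *\<^sub>R T) ` ?B"
  have det_sT: "det (s *\<^sub>R T) = s ^ ?d * det T"
    using det_rows_mul[of "\<lambda>_. s" "\<lambda>i. T $ i"] by (simp add: scaleR_vec_def vector_scalar_mult_def)
  then have "invertible (s *\<^sub>R T)" using s \<open>det T \<noteq> 0\<close> by (simp add: invertible_det_nz)
  then have "ellipsoid G" "centered_at_origin G"
    using centered_ellipsoid_iff_matrix_image G_def by blast+
  moreover have "measure lebesgue G = 1"
    using s unfolding G_def by (simp add: measure_matrix_image det_sT abs_mult \<beta>_def[symmetric] mult_ac)
  moreover have "G \<subseteq> convex hull (\<Union>i\<in>J j. E i)" if "j < r" for j
  proof -
    \<comment> \<open>By the determinant inequality the normalised combination of class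
      \<open>j\<close> describes volume at least one, so shrinking to volume one absorbs its total
      weight.\<close>
    have "s\<^sup>2 * sum u (J j) \<le> 1"
    proof (rule ccontr)
      assume "\<not> ?thesis"
      then have "1 < (s\<^sup>2 * sum u (J j)) ^ ?d" by (intro one_less_power) auto
      have "(1 / \<beta>)\<^sup>2 * sum u (J j) ^ ?d \<le> (det T)\<^sup>2"
        using det_A \<open>\<beta> > 0\<close> S_eq[OF that] T
        by (intro det_convex_combination_gram_matrices[OF fin_J, of T j u A])
          (auto simp: u_J J_def field_simps M_def)
      then have "sum u (J j) ^ ?d \<le> (\<bar>det T\<bar> * \<beta>)\<^sup>2"
        using \<open>\<beta> > 0\<close> by (simp add: field_simps power_mult_distrib)
      then have "(s ^ ?d)\<^sup>2 * sum u (J j) ^ ?d \<le> (s ^ ?d)\<^sup>2 * (\<bar>det T\<bar> * \<beta>)\<^sup>2"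
        by (rule mult_left_mono) simp
      also have "\<dots> = 1" using s(2) by (simp add: power_mult_distrib[symmetric])
      finally show False
        using \<open>1 < (s\<^sup>2 * sum u (J j)) ^ ?d\<close> by (simp add: power_mult_distrib power_mult[symmetric] mult.commute)
    qed
    then have "G \<subseteq> convex hull (\<Union>i\<in>J j. (*v) (A i) ` ?B)"
      unfolding G_def using J_ne[OF that] u_J s S_eq[OF that] T(2)
      by (intro ellipsoid_subset_convex_hull[OF fin_J]) (auto simp: M_def)
    also have "(\<Union>i\<in>J j. (*v) (A i) ` ?B) = (\<Union>i\<in>J j. E i)"
      by (auto simp: J_def A(2))
    finally show ?thesis .
  qed
  then have "G \<subseteq> (\<Inter>A\<in>P. convex hull (\<Union>i\<in>A. E i))" by (auto simp: P_def)
  ultimately show ?thesis by (intro exI[of _ P] exI[of _ G] conjI)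
qed

end
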